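(* (Completeness of $\mathsf{TC}_{\mathsf{SCI}}$.) For every $\mathsf{SCI}$-formula $\varphi$: if $\varphi$ is $\mathsf{SCI}$-valid, then $\varphi$ has a tableau proof in $\mathsf{TC}_{\mathsf{SCI}}$, i.e., there is a closed $\mathsf{TC}_{\mathsf{SCI}}$-tableau with $w^-:\varphi$ at its root for some $w^-\in\mathsf{L}^-$.
   Context: Logic SCI. Fix a countably infinite set $\mathsf{AF}$ of atomic formulas. The set $\mathsf{FOR}$ of SCI-formulas is given by $\varphi ::= p \mid \neg\varphi \mid \varphi\to\varphi \mid \varphi\equiv\varphi$ with $p\in\mathsf{AF}$. An SCI-model is a structure $\mathcal{M}=\langle U,D,\tilde\neg,\tilde\to,\tilde\equiv\rangle$ where $U\neq\emptyset$, $D\subseteq U$, $\tilde\neg:U\to U$, $\tilde\to,\tilde\equiv:U\times U\to U$, such that for all $a,b\in U$: $\tilde\neg a\in D$ iff $a\notin D$; $a\tilde\to b\in D$ iff $a\notin D$ or $b\in D$; $a\tilde\equiv b\in D$ iff $a=b$. A valuation in $\mathcal{M}$ is a map $V:\mathsf{FOR}\to U$ with $V(\neg\varphi)=\tilde\neg V(\varphi)$, $V(\varphi\to\psi)=V(\varphi)\tilde\to V(\psi)$, $V(\varphi\equiv\psi)=V(\varphi)\tilde\equiv V(\psi)$. A formula $\varphi$ is satisfied by $\mathcal{M},V$ if $V(\varphi)\in D$; valid if satisfied in every SCI-model by every valuation. Tableau system $\mathsf{TC}_{\mathsf{SCI}}$. Let $\mathsf{L}^+,\mathsf{L}^-$ be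 disjoint countably infinite sets of labels, $\mathsf{L}=\mathsf{L}^+\cup\mathsf{L}^-$; a label written $w^+$ lies in $\mathsf{L}^+$, $w^-$ in $\mathsf{L}^-$, an unsuperscripted label is arbitrary. A labelled formula is $w:\varphi$ with $w\in\mathsf{L},\varphi\in\mathsf{FOR}$. Equality statements $w=v$ and inequality statements $w\neq v$ may also occur. A tableau is a tree whose nodes carry labelled formulas, (in)equality statements or $\bot$; a branch is a root-to-leaf path, identified with the set of items on it. Rules (premises / alternative conclusion sets separated by $\mid$): Decomposition rules (all labels in the conclusions are fresh on the branch): $(\neg^+)$ $w^+:\neg\varphi$ / $v^-:\varphi$; $(\neg^-)$ $w^-:\neg\varphi$ / $v^+:\varphi$; $(\to^+)$ $w^+:\varphi\to\psi$ / $\{v^-:\varphi,u^-:\psi\}\mid\{v^-:\varphi,u^+:\psi\}\mid\{v^+:\varphi,u^+:\psi\}$; $(\to^-)$ $w^-:\varphi\to\psi$ / $\{v^+:\varphi,u^-:\psi\}$; $(\equiv^+)$ $w^+:\varphi\equiv\psi$ / $\{v^+:\varphi,u^+:\psi,v^+=u^+\}\mid\{v^-:\varphi,u^-:\psi,v^-=u^-\}$; $(\equiv^-)$ $w^-:\varphi\equiv\psi$ / $\{v^+:\varphi,u^+:\psi,v^+\neq u^+\}\mid\{v^+:\varphi,u^-:\psi\}\mid\{v^-:\varphi,u^+:\psi\}\mid\{v^-:\varphi,u^-:\psi,v^-\neq u^-\}$. Equality rules, where $\varphi\approx\psi$ abbreviates the three premises $w:\varphi$, $v:\psi$, $w=v$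 for some labels $w,v$: $(\equiv^\neg)$ $\varphi\approx\psi$, $u:\neg\varphi$, $y:\neg\psi$ / $u=y$; $(\equiv^\to)$ $\varphi\approx\psi$, $\chi\approx\theta$, $x:\varphi\to\chi$, $z:\psi\to\theta$ / $x=z$; $(\equiv^\equiv)$ $\varphi\approx\psi$, $\chi\approx\theta$, $x:\varphi\equiv\chi$, $z:\psi\equiv\theta$ / $x=z$; $(\mathsf F)$ $w:\varphi$, $v:\varphi$ / $w=v$; $(\mathsf{sym})$ $w=v$ / $v=w$; $(\mathsf{tran})$ $w=v$, $v=u$ / $w=u$. Closure rules: $(\bot_1)$ $w=v$, $w\neq v$ / $\bot$; $(\bot_2)$ $w^+=v^-$ / $\bot$. A decomposition rule may be applied to $w:\varphi$ on a branch only if it has not been applied to $w:\varphi$ on that branch before; an equality rule may be applied only if its conclusion is not already on the branch. Closure rules are applied eagerly. A branch is closed if a closure rule has been applied on it, open otherwise; a tableau is closed if all its branches are closed. A tableau proof of $\varphi$ is a closed tableau with $w^-:\varphi$ at its root. *)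

theory Defs
  imports Main "HOL-Library.Countable" "HOL-Library.Countable_Set"
begin

section \<open>Formulas and models of SCI\<close>

datatype fm =
    Atom nat
  | Neg fm
  | Imp fm fm
  | Iden fm fm

record 'u sci_struct =
  univ :: "'u set"
  desig :: "'u set"
  negS :: "'u \<Rightarrow> 'u"
  impS :: "'u \<Rightarrow> 'u \<Rightarrow> 'u"
  idenS :: "'u \<Rightarrow> 'u \<Rightarrow> 'u"

definition sci_model :: "'u sci_struct \<Rightarrow> bool" where
  "sci_model M \<longleftrightarrow>
     univ M \<noteq> {} \<and> desig M \<subseteq> univ M \<and>
     (\<forall>a\<in>univ M. negS M a \<in> univ M) \<and>
     (\<forall>a\<in>univ M. \<forall>b\<in>univ M. impS M a b \<in> univ M \<and> idenS M a b \<in> univ M) \<and>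
     (\<forall>a\<in>univ M. negS M a \<in> desig M \<longleftrightarrow> a \<notin> desig M) \<and>
     (\<forall>a\<in>univ M. \<forall>b\<in>univ M. impS M a b \<in> desig M \<longleftrightarrow> a \<notin> desig M \<or> b \<in> desig M) \<and>
     (\<forall>a\<in>univ M. \<forall>b\<in>univ M. idenS M a b \<in> desig M \<longleftrightarrow> a = b)"

definition valuation :: "'u sci_struct \<Rightarrow> (fm \<Rightarrow> 'u) \<Rightarrow> bool" where
  "valuation M V \<longleftrightarrow>
     (\<forall>\<phi>. V \<phi> \<in> univ M) \<and>
     (\<forall>\<phi>. V (Neg \<phi>) = negS M (V \<phi>)) \<and>
     (\<forall>\<phi> \<psi>. V (Imp \<phi> \<psi>) = impS M (V \<phi>) (V \<psi>)) \<and>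
     (\<forall>\<phi> \<psi>. V (Iden \<phi> \<psi>) = idenS M (V \<phi>) (V \<psi>))"

definition satisfied :: "'u sci_struct \<Rightarrow> (fm \<Rightarrow> 'u) \<Rightarrow> fm \<Rightarrow> bool" where
  "satisfied M V \<phi> \<longleftrightarrow> V \<phi> \<in> desig M"

text \<open>A formula cannot quantify over types, so validity ranges over the models whose universe is a
  set of natural numbers. Lemma \<open>valid_all_universes\<close> below shows that this gives satisfaction in
  all models over every type: the range of a valuation is the universe of a countable submodel.\<close>

definition valid :: "fm \<Rightarrow> bool" where
  "valid \<phi> \<longleftrightarrow>
     (\<forall>(M :: nat sci_struct) V. sci_model M \<longrightarrow> valuation M V \<longrightarrow> satisfied M V \<phi>)"

instance fm :: countable
  by countable_datatype

lemma valid_all_universes: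
  fixes M :: "'u sci_struct"
  assumes "valid \<phi>" and M: "sci_model M" and V: "valuation M V"
  shows "satisfied M V \<phi>"
proof -
  define g where "g = to_nat_on (range V)"
  define h where "h = from_nat_into (range V)"
  have hg: "h (g (V \<psi>)) = V \<psi>" for \<psi>
    unfolding g_def h_def by (rule from_nat_into_to_nat_on) auto
  define N :: "nat sci_struct" where
    "N = \<lparr>univ = range (g \<circ> V), desig = {n \<in> range (g \<circ> V). h n \<in> desig M},
          negS = (\<lambda>a. g (negS M (h a))), impS = (\<lambda>a b. g (impS M (h a) (h b))),
          idenS = (\<lambda>a b. g (idenS M (h a) (h b)))\<rparr>"
  have ops: "negS M (V \<psi>) = V (Neg \<psi>)" "impS M (V \<psi>) (V \<chi>) = V (Imp \<psi> \<chi>)"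
    "idenS M (V \<psi>) (V \<chi>) = V (Iden \<psi> \<chi>)" "V \<psi> \<in> univ M" for \<psi> \<chi>
    using V by (simp_all add: valuation_def)
  have des: "V (Neg \<psi>) \<in> desig M \<longleftrightarrow> V \<psi> \<notin> desig M"
    "V (Imp \<psi> \<chi>) \<in> desig M \<longleftrightarrow> V \<psi> \<notin> desig M \<or> V \<chi> \<in> desig M"
    "V (Iden \<psi> \<chi>) \<in> desig M \<longleftrightarrow> V \<psi> = V \<chi>" for \<psi> \<chi>
    using M unfolding sci_model_def by (simp_all flip: ops(1-3) add: ops(4))
  have g_eq: "g (V \<psi>) = g (V \<chi>) \<longleftrightarrow> V \<psi> = V \<chi>" for \<psi> \<chi>
    by (metis hg)
  have "sci_model N"
    unfolding sci_model_def N_def by (auto simp: hg ops(1-3) des g_eq)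
  moreover have "valuation N (g \<circ> V)"
    unfolding valuation_def N_def by (auto simp: hg ops(1-3))
  ultimately have "satisfied N (g \<circ> V) \<phi>"
    using \<open>valid \<phi>\<close> by (simp add: valid_def)
  then show ?thesis
    by (simp add: satisfied_def N_def hg)
qed


section \<open>The tableau system\<close>

datatype label = LPos nat | LNeg nat

datatype item =
    LF label fm
  | LEq label label
  | LNeq label label
  | Bot

fun item_labels :: "item \<Rightarrow> label set" where
  "item_labels (LF w \<phi>) = {w}"
| "item_labels (LEq w v) = {w, v}"
| "item_labels (LNeq w v) = {w, v}"
| "item_labels Bot = {}"

definition labels :: "item set \<Rightarrow> label set" where
  "labels B = (\<Union>x\<in>B. item_labels x)"

text \<open>In \<open>decomp w \<phi> Cs\<close>, the list \<open>Cs\<close> contains the alternative conclusion sets for the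
  premise \<open>w : \<phi>\<close>. Labels introduced together are pairwise different; freshness with respect to
  the branch is imposed where rules are applied.\<close>

inductive decomp :: "label \<Rightarrow> fm \<Rightarrow> item set list \<Rightarrow> bool" where
  neg_pos: "decomp (LPos w) (Neg \<phi>) [{LF (LNeg v) \<phi>}]"
| neg_neg: "decomp (LNeg w) (Neg \<phi>) [{LF (LPos v) \<phi>}]"
| imp_pos: "v' \<noteq> u' \<Longrightarrow> v \<noteq> u \<Longrightarrow>
    decomp (LPos w) (Imp \<phi> \<psi>)
      [{LF (LNeg v') \<phi>, LF (LNeg u') \<psi>},
       {LF (LNeg v') \<phi>, LF (LPos u) \<psi>},
       {LF (LPos v) \<phi>, LF (LPos u) \<psi>}]"
| imp_neg: "decomp (LNeg w) (Imp \<phi> \<psi>) [{LF (LPos v) \<phi>, LF (LNeg u') \<psi>}]"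
| iden_pos: "v' \<noteq> u' \<Longrightarrow> v \<noteq> u \<Longrightarrow>
    decomp (LPos w) (Iden \<phi> \<psi>)
      [{LF (LPos v) \<phi>, LF (LPos u) \<psi>, LEq (LPos v) (LPos u)},
       {LF (LNeg v') \<phi>, LF (LNeg u') \<psi>, LEq (LNeg v') (LNeg u')}]"
| iden_neg: "v' \<noteq> u' \<Longrightarrow> v \<noteq> u \<Longrightarrow>
    decomp (LNeg w) (Iden \<phi> \<psi>)
      [{LF (LPos v) \<phi>, LF (LPos u) \<psi>, LNeq (LPos v) (LPos u)},
       {LF (LPos v) \<phi>, LF (LNeg u') \<psi>},
       {LF (LNeg v') \<phi>, LF (LPos u) \<psi>},
       {LF (LNeg v') \<phi>, LF (LNeg u') \<psi>, LNeq (LNeg v') (LNeg u')}]"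

definition approx :: "item set \<Rightarrow> fm \<Rightarrow> fm \<Rightarrow> bool" where
  "approx B \<phi> \<psi> \<longleftrightarrow> (\<exists>w v. LF w \<phi> \<in> B \<and> LF v \<psi> \<in> B \<and> LEq w v \<in> B)"

inductive equality_rule :: "item set \<Rightarrow> item \<Rightarrow> bool" for B where
  eq_neg: "approx B \<phi> \<psi> \<Longrightarrow> LF u (Neg \<phi>) \<in> B \<Longrightarrow> LF y (Neg \<psi>) \<in> B \<Longrightarrow>
    equality_rule B (LEq u y)"
| eq_imp: "approx B \<phi> \<psi> \<Longrightarrow> approx B \<chi> \<theta> \<Longrightarrow> LF x (Imp \<phi> \<chi>) \<in> B \<Longrightarrow> LF z (Imp \<psi> \<theta>) \<in> B \<Longrightarrow>
    equality_rule B (LEq x z)"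
| eq_iden: "approx B \<phi> \<psi> \<Longrightarrow> approx B \<chi> \<theta> \<Longrightarrow> LF x (Iden \<phi> \<chi>) \<in> B \<Longrightarrow> LF z (Iden \<psi> \<theta>) \<in> B \<Longrightarrow>
    equality_rule B (LEq x z)"
| eq_F: "LF w \<phi> \<in> B \<Longrightarrow> LF v \<phi> \<in> B \<Longrightarrow> equality_rule B (LEq w v)"
| eq_sym: "LEq w v \<in> B \<Longrightarrow> equality_rule B (LEq v w)"
| eq_tran: "LEq w v \<in> B \<Longrightarrow> LEq v u \<in> B \<Longrightarrow> equality_rule B (LEq w u)"

inductive closure_rule :: "item set \<Rightarrow> bool" for B where
  bot1: "LEq w v \<in> B \<Longrightarrow> LNeq w v \<in> B \<Longrightarrow> closure_rule B"
| bot2: "LEq (LPos w) (LNeg v) \<in> B \<Longrightarrow> closure_rule B"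

text \<open>A node carries the conclusion set added at that point; the list holds its children.\<close>

datatype tree = Node (items: "item set") (children: "tree list")

text \<open>\<open>expansion B A ts\<close>: the list \<open>ts\<close> of subtrees correctly continues, by successive rule
  applications, a branch with the items \<open>B\<close> on which the labelled formulas in \<open>A\<close> have
  already been decomposed. Eagerness of the closure rules means that no other rule is applied to a
  branch to which a closure rule is applicable.\<close>

inductive expansion :: "item set \<Rightarrow> (label \<times> fm) set \<Rightarrow> tree list \<Rightarrow> bool" where
  stop: "expansion B A []"
| closure: "closure_rule B \<Longrightarrow> expansion B A [Node {Bot} []]"
| equality: "\<not> closure_rule B \<Longrightarrow> equality_rule B x \<Longrightarrow> x \<notin> B \<Longrightarrow>
    expansion (insert x B) A ts \<Longrightarrow> expansion B A [Node {x} ts]"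
| decomposition: "\<not> closure_rule B \<Longrightarrow> LF w \<phi> \<in> B \<Longrightarrow> (w, \<phi>) \<notin> A \<Longrightarrow> decomp w \<phi> Cs \<Longrightarrow>
    (\<And>C. C \<in> set Cs \<Longrightarrow> labels C \<inter> labels B = {}) \<Longrightarrow>
    list_all2 (\<lambda>C t. items t = C \<and> expansion (B \<union> C) (insert (w, \<phi>) A) (children t)) Cs ts \<Longrightarrow>
    expansion B A ts"

definition tableau :: "tree \<Rightarrow> bool" where
  "tableau t \<longleftrightarrow> expansion (items t) {} (children t)"

fun branches :: "tree \<Rightarrow> item set set" where
  "branches (Node C ts) = (if ts = [] then {C} else (\<Union>t\<in>set ts. (\<lambda>B. C \<union> B) ` branches t))"

definition closed :: "tree \<Rightarrow> bool" where
  "closed t \<longleftrightarrow> (\<forall>B\<in>branches t. Bot \<in> B)"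

definition tableau_proof :: "tree \<Rightarrow> fm \<Rightarrow> bool" where
  "tableau_proof t \<phi> \<longleftrightarrow> tableau t \<and> closed t \<and> (\<exists>w. items t = {LF (LNeg w) \<phi>})"

end

theory Submission
  imports Defs
begin

text \<open>If no closed continuation of a branch exists, some rule application leads to a longer branch
  with the same property. Decomposition trades a pending formula for smaller ones, and equality
  rules introduce no labels, so the process ends in an open branch saturated under all rules.
  On such a branch \<open>approx\<close> is an equivalence and a partial congruence, and the signs of the labels
  are constant on its classes. Two extra elements, one designated and one not, serve as values
  of the operations that the branch leaves undetermined; this gives a countermodel.\<close>

section \<open>Saturation\<close>

text \<open>The conjunct \<open>ts \<noteq> []\<close> excludes \<open>stop\<close>, whose empty
  list would make the closedness condition vacuous.\<close>

definition closable :: "item set \<Rightarrow> (label \<times> fm) set \<Rightarrow> bool" where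
  "closable B A \<longleftrightarrow> (\<exists>ts. expansion B A ts \<and> ts \<noteq> [] \<and> (\<forall>t\<in>set ts. closed t))"

lemma closed_Node:
  assumes "ts \<noteq> []" "\<forall>t\<in>set ts. closed t"
  shows "closed (Node C ts)"
  using assms by (auto simp: closed_def)

lemma closable_closure: "closure_rule B \<Longrightarrow> closable B A"
  unfolding closable_def
  by (rule exI[of _ "[Node {Bot} []]"]) (auto intro: expansion.closure simp: closed_def)

lemma closable_equality:
  assumes "\<not> closure_rule B" "equality_rule B x" "x \<notin> B" "closable (insert x B) A"
  shows "closable B A"
proof -
  obtain ts where ts: "expansion (insert x B) A ts" "ts \<noteq> []" "\<forall>t\<in>set ts. closed t"
    using assms(4) by (auto simp: closable_def)
  have "expansion B A [Node {x} ts]"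
    using assms ts by (intro expansion.equality)
  moreover have "closed (Node {x} ts)"
    using ts by (intro closed_Node)
  ultimately show ?thesis
    unfolding closable_def by (intro exI[of _ "[Node {x} ts]"]) simp
qed

lemma decomp_nonempty: "decomp w \<phi> Cs \<Longrightarrow> Cs \<noteq> []"
  by (erule decomp.cases) auto

text \<open>Closed continuations chosen for the separate alternatives are hung side by side.
  Contrapositively, a branch that cannot be closed has a conclusion set after which it still
  cannot.\<close>

lemma closable_decomposition:
  assumes "\<not> closure_rule B" "LF w \<phi> \<in> B" "(w, \<phi>) \<notin> A" "decomp w \<phi> Cs"
    and fresh: "\<And>C. C \<in> set Cs \<Longrightarrow> labels C \<inter> labels B = {}"
    and closable: "\<And>C. C \<in> set Cs \<Longrightarrow> closable (B \<union> C) (insert (w, \<phi>) A)"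
  shows "closable B A"
proof -
  obtain f where f: "\<And>C. C \<in> set Cs \<Longrightarrow>
      expansion (B \<union> C) (insert (w, \<phi>) A) (f C) \<and> f C \<noteq> [] \<and> (\<forall>t\<in>set (f C). closed t)"
    using closable unfolding closable_def by metis
  define ts where "ts = map (\<lambda>C. Node C (f C)) Cs"
  have "expansion B A ts"
    using assms(1-4) fresh
  proof (rule expansion.decomposition)
    show "list_all2 (\<lambda>C t. items t = C \<and>
        expansion (B \<union> C) (insert (w, \<phi>) A) (children t)) Cs ts"
      using f by (auto simp: ts_def list.rel_map intro!: list.rel_refl_strong)
  qed
  moreover have "ts \<noteq> []"
    using decomp_nonempty[OF assms(4)] by (simp add: ts_def)
  moreover have "\<forall>t\<in>set ts. closed t"
    using f by (auto simp: ts_def intro!: closed_Node)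
  ultimately show ?thesis
    unfolding closable_def by blast
qed

section \<open>Fresh labels on finite branches\<close>

lemma finite_item_labels: "finite (item_labels x)"
  by (cases x) simp_all

lemma finite_labels: "finite B \<Longrightarrow> finite (labels B)"
  unfolding labels_def by (simp add: finite_item_labels)

lemma fresh_bound:
  assumes "finite L"
  obtains n where "\<And>m. m \<ge> n \<Longrightarrow> LPos m \<notin> L \<and> LNeg m \<notin> L"
proof -
  have "finite (LPos -` L \<union> LNeg -` L)"
    using assms by (simp add: finite_vimageI inj_def)
  then obtain n where "\<forall>m\<in>LPos -` L \<union> LNeg -` L. m < n"
    using finite_nat_set_iff_bounded by blast
  then show ?thesis
    by (intro that[of n]) (auto simp: not_less[symmetric])
qed

lemma fresh_decomp:
  assumes "finite L" "\<And>n. \<phi> \<noteq> Atom n"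
  obtains Cs where "decomp w \<phi> Cs" "\<And>C. C \<in> set Cs \<Longrightarrow> labels C \<inter> L = {}"
proof -
  obtain n where n: "\<And>m. m \<ge> n \<Longrightarrow> LPos m \<notin> L \<and> LNeg m \<notin> L"
    using fresh_bound[OF assms(1)] by blast
  \<comment> \<open>No conclusion set has more than two labels of one sign, so the indices
    \<open>n\<close> and \<open>Suc n\<close> suffice; being distinct, they also meet the side
    conditions of the rules.\<close>
  have fresh: "LPos n \<notin> L" "LNeg n \<notin> L" "LPos (Suc n) \<notin> L" "LNeg (Suc n) \<notin> L"
    using n[of n] n[of "Suc n"] by auto
  have "\<exists>Cs. decomp w \<phi> Cs \<and> (\<forall>C\<in>set Cs. labels C \<inter> L = {})"
  proof (cases w; cases \<phi>)
    fix k \<psi> assume "w = LPos k" "\<phi> = Neg \<psi>"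
    with decomp.neg_pos[of k \<psi> n] fresh show ?thesis
      by (simp only:) (rule exI, rule conjI, assumption, simp add: labels_def)
  next
    fix k \<psi> assume "w = LNeg k" "\<phi> = Neg \<psi>"
    with decomp.neg_neg[of k \<psi> n] fresh show ?thesis
      by (simp only:) (rule exI, rule conjI, assumption, simp add: labels_def)
  next
    fix k \<psi> \<chi> assume "w = LPos k" "\<phi> = Imp \<psi> \<chi>"
    with decomp.imp_pos[OF n_not_Suc_n[of n] n_not_Suc_n[of n], of k \<psi> \<chi>] fresh show ?thesis
      by (simp only:) (rule exI, rule conjI, assumption, simp add: labels_def)
  next
    fix k \<psi> \<chi> assume "w = LNeg k" "\<phi> = Imp \<psi> \<chi>"
    with decomp.imp_neg[of k \<psi> \<chi> n n] fresh show ?thesis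
      by (simp only:) (rule exI, rule conjI, assumption, simp add: labels_def)
  next
    fix k \<psi> \<chi> assume "w = LPos k" "\<phi> = Iden \<psi> \<chi>"
    with decomp.iden_pos[OF n_not_Suc_n[of n] n_not_Suc_n[of n], of k \<psi> \<chi>] fresh show ?thesis
      by (simp only:) (rule exI, rule conjI, assumption, simp add: labels_def)
  next
    fix k \<psi> \<chi> assume "w = LNeg k" "\<phi> = Iden \<psi> \<chi>"
    with decomp.iden_neg[OF n_not_Suc_n[of n] n_not_Suc_n[of n], of k \<psi> \<chi>] fresh show ?thesis
      by (simp only:) (rule exI, rule conjI, assumption, simp add: labels_def)
  qed (use assms(2) in auto)
  then show ?thesis
    using that by blast
qed

section \<open>Termination measure\<close>

definition pending :: "item set \<Rightarrow> (label \<times> fm) set \<Rightarrow> (label \<times> fm) set" where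
  "pending B A = {(w, \<phi>). LF w \<phi> \<in> B \<and> (w, \<phi>) \<notin> A}"

definition weight :: "item set \<Rightarrow> (label \<times> fm) set \<Rightarrow> nat" where
  "weight B A = (\<Sum>(w, \<phi>)\<in>pending B A. size \<phi>)"

text \<open>Second component of a lexicographic measure: decomposition may create missing pairs but
  lowers \<open>weight\<close>, while an equality rule keeps \<open>weight\<close> and fills one
  pair.\<close>

definition missing :: "item set \<Rightarrow> (label \<times> label) set" where
  "missing B = {(w, v) \<in> labels B \<times> labels B. LEq w v \<notin> B}"

lemma finite_pending:
  assumes "finite B"
  shows "finite (pending B A)"
proof (rule finite_subset)
  show "pending B A \<subseteq> (\<lambda>(w, \<phi>). LF w \<phi>) -` B"
    by (auto simp: pending_def)
  show "finite ((\<lambda>(w, \<phi>). LF w \<phi>) -` B)"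
    using assms by (intro finite_vimageI) (auto simp: inj_def)
qed

lemma decomp_finite: "decomp w \<phi> Cs \<Longrightarrow> C \<in> set Cs \<Longrightarrow> finite C"
  by (erule decomp.cases) auto

lemma pending_insert:
  "pending {} A = {}"
  "pending (insert (LF w \<phi>) B) A
    = (if (w, \<phi>) \<in> A then pending B A else insert (w, \<phi>) (pending B A))"
  "pending (insert (LEq w v) B) A = pending B A"
  "pending (insert (LNeq w v) B) A = pending B A"
  by (auto simp: pending_def)

text \<open>A conclusion set carries each immediate subformula once, and a compound formula is
  larger than these together.\<close>

lemma decomp_weight:
  assumes "decomp w \<phi> Cs" "C \<in> set Cs"
  shows "weight C {} < size \<phi>"
  using assms by cases (auto simp: weight_def pending_insert)

lemma weight_decomposition:
  assumes "finite B" "LF w \<phi> \<in> B" "(w, \<phi>) \<notin> A" "decomp w \<phi> Cs" "C \<in> set Cs"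
  shows "weight (B \<union> C) (insert (w, \<phi>) A) < weight B A"
proof -
  let ?f = "\<lambda>(w :: label, \<phi> :: fm). size \<phi>"
  note fin = finite_pending[OF assms(1)] finite_pending[OF decomp_finite[OF assms(4,5)]]
  \<comment> \<open>The formulas still pending are among the old ones without the premise and those
    of \<open>C\<close>; counting \<open>C\<close> against \<open>{}\<close> can only enlarge the
    sum.\<close>
  have "weight (B \<union> C) (insert (w, \<phi>) A)
      \<le> sum ?f ((pending B A - {(w, \<phi>)}) \<union> pending C {})"
    unfolding weight_def by (rule sum_mono2) (auto simp: fin, auto simp: pending_def)
  also have "\<dots> \<le> sum ?f (pending B A - {(w, \<phi>)}) + weight C {}"
    unfolding weight_def using fin by (subst sum_Un_nat) auto
  also have "\<dots> < sum ?f (pending B A - {(w, \<phi>)}) + size \<phi>"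
    using decomp_weight[OF assms(4,5)] by simp
  also have "\<dots> = weight B A"
    unfolding weight_def using assms(2,3) fin
    by (subst (2) sum.remove[of _ "(w, \<phi>)"]) (auto simp: pending_def)
  finally show ?thesis .
qed

lemma equality_rule_LEq:
  assumes "equality_rule B x"
  obtains w v where "x = LEq w v" "w \<in> labels B" "v \<in> labels B"
proof -
  have "LF w \<phi> \<in> B \<Longrightarrow> w \<in> labels B" "LEq w v \<in> B \<Longrightarrow> w \<in> labels B \<and> v \<in> labels B" for w v \<phi>
    by (force simp: labels_def)+
  with assms show ?thesis
    by cases (auto intro: that)
qed

lemma weight_equality:
  assumes "equality_rule B x"
  shows "weight (insert x B) A = weight B A"
  using assms by (auto simp: weight_def pending_def elim!: equality_rule_LEq)

lemma missing_equality:
  assumes "finite B" "equality_rule B x" "x \<notin> B"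
  shows "card (missing (insert x B)) < card (missing B)"
proof -
  obtain w v where x: "x = LEq w v" "w \<in> labels B" "v \<in> labels B"
    using equality_rule_LEq[OF assms(2)] .
  have "labels (insert x B) = labels B"
    using x by (auto simp: labels_def)
  then have "missing (insert x B) \<subset> missing B"
    using x assms(3) by (auto simp: missing_def)
  moreover have "finite (missing B)"
    by (rule finite_subset[of _ "labels B \<times> labels B"])
      (use finite_labels[OF assms(1)] in \<open>auto simp: missing_def\<close>)
  ultimately show ?thesis
    by (rule psubset_card_mono[rotated])
qed

section \<open>Saturated branches\<close>

definition decomposed :: "item set \<Rightarrow> label \<Rightarrow> fm \<Rightarrow> bool" where
  "decomposed B w \<phi> \<longleftrightarrow> (\<exists>Cs C. decomp w \<phi> Cs \<and> C \<in> set Cs \<and> C \<subseteq> B)"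

lemma decomposed_mono: "decomposed B w \<phi> \<Longrightarrow> B \<subseteq> B' \<Longrightarrow> decomposed B' w \<phi>"
  unfolding decomposed_def by blast

text \<open>These conditions are all that the countermodel takes from the tableau. Atoms are exempt
  because no rule decomposes them.\<close>

locale open_branch =
  fixes B :: "item set"
  assumes not_closed: "\<not> closure_rule B"
    and equality_in: "equality_rule B x \<Longrightarrow> x \<in> B"
    and decomposed: "LF w \<phi> \<in> B \<Longrightarrow> (\<And>n. \<phi> \<noteq> Atom n) \<Longrightarrow> decomposed B w \<phi>"

text \<open>The hypothesis on \<open>A\<close> is the invariant of the induction: formulas marked as
  used already have a conclusion set on the branch. When no further step is possible, every compound
  formula is marked, and the invariant yields saturation.\<close>

lemma open_branch_extension:
  assumes "finite B" "\<And>w \<phi>. (w, \<phi>) \<in> A \<Longrightarrow> decomposed B w \<phi>" "\<not> closable B A"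
  shows "\<exists>B'. B \<subseteq> B' \<and> open_branch B'"
  using assms
proof (induction "(B, A)" arbitrary: B A
    rule: wf_induct_rule[OF wf_measures[of "[\<lambda>(B, A). weight B A, \<lambda>(B, A). card (missing B)]"]])
  case 1
  note IH = 1(1) and fin = 1(2) and dec = 1(3) and nc = 1(4)
  have ncl: "\<not> closure_rule B"
    using nc closable_closure by blast
  show ?case
  proof (cases "\<exists>x. equality_rule B x \<and> x \<notin> B")
    case True
    then obtain x where x: "equality_rule B x" "x \<notin> B"
      by blast
    have "\<exists>B'. insert x B \<subseteq> B' \<and> open_branch B'"
    proof (rule IH)
      show "((insert x B, A), B, A)
          \<in> measures [\<lambda>(B, A). weight B A, \<lambda>(B, A). card (missing B)]"
        using weight_equality[OF x(1)] missing_equality[OF fin x] by simp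
      show "decomposed (insert x B) w \<phi>" if "(w, \<phi>) \<in> A" for w \<phi>
        using decomposed_mono[OF dec[OF that]] by blast
      show "\<not> closable (insert x B) A"
        using closable_equality[OF ncl x] nc by blast
    qed (use fin in simp)
    then show ?thesis
      by blast
  next
    case saturated: False
    show ?thesis
    proof (cases "\<exists>w \<phi>. LF w \<phi> \<in> B \<and> (w, \<phi>) \<notin> A \<and> (\<forall>n. \<phi> \<noteq> Atom n)")
      case True
      then obtain w \<phi> where w: "LF w \<phi> \<in> B" "(w, \<phi>) \<notin> A" "\<And>n. \<phi> \<noteq> Atom n"
        by blast
      obtain Cs where Cs: "decomp w \<phi> Cs" "\<And>C. C \<in> set Cs \<Longrightarrow> labels C \<inter> labels B = {}"
        using fresh_decomp[OF finite_labels[OF fin] w(3)] by metis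
      obtain C where C: "C \<in> set Cs" "\<not> closable (B \<union> C) (insert (w, \<phi>) A)"
        using closable_decomposition[OF ncl w(1,2) Cs] nc by blast
      have "\<exists>B'. B \<union> C \<subseteq> B' \<and> open_branch B'"
      proof (rule IH)
        show "((B \<union> C, insert (w, \<phi>) A), B, A)
            \<in> measures [\<lambda>(B, A). weight B A, \<lambda>(B, A). card (missing B)]"
          using weight_decomposition[OF fin w(1,2) Cs(1) C(1)] by simp
        show "decomposed (B \<union> C) v \<psi>" if "(v, \<psi>) \<in> insert (w, \<phi>) A" for v \<psi>
        proof (cases "(v, \<psi>) = (w, \<phi>)")
          case True
          then show ?thesis
            using Cs(1) C(1) unfolding decomposed_def by blast
        next
          case False
          then show ?thesis
            using that decomposed_mono[OF dec] by blast
        qed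
      qed (use fin decomp_finite[OF Cs(1) C(1)] C(2) in auto)
      then show ?thesis
        by blast
    next
      case False
      then have "open_branch B"
        using saturated ncl dec by unfold_locales blast+
      then show ?thesis
        by blast
    qed
  qed
qed

section \<open>The countermodel\<close>

context open_branch
begin

section \<open>The relation \<open>approx\<close> and the signs of formulas\<close>

definition occurs :: "fm \<Rightarrow> bool" where
  "occurs \<phi> \<longleftrightarrow> (\<exists>w. LF w \<phi> \<in> B)"

definition positive :: "fm \<Rightarrow> bool" where
  "positive \<phi> \<longleftrightarrow> (\<exists>n. LF (LPos n) \<phi> \<in> B)"

lemma eq_same: "LF w \<phi> \<in> B \<Longrightarrow> LF v \<phi> \<in> B \<Longrightarrow> LEq w v \<in> B"
  by (rule equality_in[OF eq_F])

lemma eq_trans: "LEq w v \<in> B \<Longrightarrow> LEq v u \<in> B \<Longrightarrow> LEq w u \<in> B"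
  by (rule equality_in[OF eq_tran])

lemma eq_symm: "LEq w v \<in> B \<Longrightarrow> LEq v w \<in> B"
  by (rule equality_in[OF eq_sym])

text \<open>\<open>approx\<close> only supplies some pair of equated labels. By \<open>eq_F\<close>
  all labels of one formula are equated, so transitivity reaches any chosen pair.\<close>

lemma approx_labels:
  assumes "approx B \<phi> \<psi>" "LF w \<phi> \<in> B" "LF v \<psi> \<in> B"
  shows "LEq w v \<in> B"
  using assms unfolding approx_def by (meson eq_same eq_trans)

lemma approx_refl: "approx B \<phi> \<phi> \<longleftrightarrow> occurs \<phi>"
  unfolding approx_def occurs_def using eq_same by blast

lemma approx_sym: "approx B \<phi> \<psi> \<Longrightarrow> approx B \<psi> \<phi>"
  unfolding approx_def using eq_symm by blast

lemma approx_trans: "approx B \<phi> \<psi> \<Longrightarrow> approx B \<psi> \<chi> \<Longrightarrow> approx B \<phi> \<chi>"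
  by (meson approx_def approx_labels eq_trans)

lemma eq_signs: "LEq (LPos n) (LNeg m) \<notin> B" "LEq (LNeg m) (LPos n) \<notin> B"
  using not_closed bot2 eq_symm by blast+

text \<open>Labels of opposite sign on one formula would be equated by \<open>eq_F\<close>. Hence
  the sign belongs to the formula, not just to one occurrence.\<close>

lemma negative: "LF (LNeg n) \<phi> \<in> B \<Longrightarrow> \<not> positive \<phi>"
  unfolding positive_def using eq_same eq_signs by blast

lemma approx_positive:
  assumes "approx B \<phi> \<psi>"
  shows "positive \<phi> \<longleftrightarrow> positive \<psi>"
proof -
  have "positive \<psi>" if "approx B \<phi> \<psi>" "positive \<phi>" for \<phi> \<psi>
  proof -
    obtain n v where "LF (LPos n) \<phi> \<in> B" "LF v \<psi> \<in> B"
      using \<open>approx B \<phi> \<psi>\<close> \<open>positive \<phi>\<close> unfolding approx_def positive_def by blast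
    then show ?thesis
      using approx_labels[OF that(1)] eq_signs unfolding positive_def by (cases v) blast+
  qed
  then show ?thesis
    using assms approx_sym by blast
qed

section \<open>Congruence and truth conditions on the branch\<close>

lemma approx_Neg:
  "approx B \<phi> \<psi> \<Longrightarrow> occurs (Neg \<phi>) \<Longrightarrow> occurs (Neg \<psi>) \<Longrightarrow> approx B (Neg \<phi>) (Neg \<psi>)"
  unfolding occurs_def by (metis approx_def eq_neg equality_in)

lemma approx_Imp:
  "approx B \<phi> \<psi> \<Longrightarrow> approx B \<chi> \<theta> \<Longrightarrow> occurs (Imp \<phi> \<chi>) \<Longrightarrow> occurs (Imp \<psi> \<theta>) \<Longrightarrow>
    approx B (Imp \<phi> \<chi>) (Imp \<psi> \<theta>)"
  unfolding occurs_def by (metis approx_def eq_imp equality_in)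

lemma approx_Iden:
  "approx B \<phi> \<psi> \<Longrightarrow> approx B \<chi> \<theta> \<Longrightarrow> occurs (Iden \<phi> \<chi>) \<Longrightarrow> occurs (Iden \<psi> \<theta>) \<Longrightarrow>
    approx B (Iden \<phi> \<chi>) (Iden \<psi> \<theta>)"
  unfolding occurs_def by (metis approx_def eq_iden equality_in)

lemma positiveI: "LF (LPos n) \<phi> \<in> B \<Longrightarrow> positive \<phi>"
  unfolding positive_def by blast

lemma occurs_decomposed:
  assumes "occurs \<phi>" "\<And>n. \<phi> \<noteq> Atom n"
  obtains w Cs C where "LF w \<phi> \<in> B" "decomp w \<phi> Cs" "C \<in> set Cs" "C \<subseteq> B"
  using assms decomposed unfolding occurs_def decomposed_def by blast

text \<open>Decomposing a single occurrence is enough: by \<open>negative\<close>, the sign of its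
  label is that of the formula everywhere.\<close>

lemma occurs_Neg:
  assumes "occurs (Neg \<phi>)"
  shows "occurs \<phi>" "positive (Neg \<phi>) \<longleftrightarrow> \<not> positive \<phi>"
proof -
  obtain w Cs C where C: "LF w (Neg \<phi>) \<in> B" "decomp w (Neg \<phi>) Cs" "C \<in> set Cs" "C \<subseteq> B"
    using occurs_decomposed[OF assms] by blast
  show "occurs \<phi>"
    using C(2-4) by cases (auto simp: occurs_def)
  show "positive (Neg \<phi>) \<longleftrightarrow> \<not> positive \<phi>"
    using C(2,1,3,4) by cases (auto dest: negative positiveI)
qed

lemma occurs_Imp:
  assumes "occurs (Imp \<phi> \<psi>)"
  shows "occurs \<phi>" "occurs \<psi>" "positive (Imp \<phi> \<psi>) \<longleftrightarrow> \<not> positive \<phi> \<or> positive \<psi>"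
proof -
  obtain w Cs C where C: "LF w (Imp \<phi> \<psi>) \<in> B" "decomp w (Imp \<phi> \<psi>) Cs" "C \<in> set Cs" "C \<subseteq> B"
    using occurs_decomposed[OF assms] by blast
  show "occurs \<phi>" "occurs \<psi>"
    using C(2-4) by (cases; auto simp: occurs_def)+
  show "positive (Imp \<phi> \<psi>) \<longleftrightarrow> \<not> positive \<phi> \<or> positive \<psi>"
    using C(2,1,3,4) by cases (auto dest: negative positiveI)
qed

lemma neq_not_approx:
  assumes "LF w \<phi> \<in> B" "LF v \<psi> \<in> B" "LNeq w v \<in> B"
  shows "\<not> approx B \<phi> \<psi>"
  using assms approx_labels not_closed bot1 by blast

lemma occurs_Iden:
  assumes "occurs (Iden \<phi> \<psi>)"
  shows "occurs \<phi>" "occurs \<psi>" "positive (Iden \<phi> \<psi>) \<longleftrightarrow> approx B \<phi> \<psi>"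
proof -
  obtain w Cs C where C: "LF w (Iden \<phi> \<psi>) \<in> B" "decomp w (Iden \<phi> \<psi>) Cs" "C \<in> set Cs" "C \<subseteq> B"
    using occurs_decomposed[OF assms] by blast
  show "occurs \<phi>" "occurs \<psi>"
    using C(2-4) by (cases; auto simp: occurs_def)+
  show "positive (Iden \<phi> \<psi>) \<longleftrightarrow> approx B \<phi> \<psi>"
    using C(2)
  proof cases
    case (iden_pos v' u' v u k)
    then have "approx B \<phi> \<psi>"
      using C(3,4) by (auto simp: approx_def)
    then show ?thesis
      using C(1) iden_pos positiveI by blast
  next
    case (iden_neg v' u' v u k)
    \<comment> \<open>The four alternatives are of two kinds: equal signs with an inequality,
      incompatible with \<open>approx\<close> by \<open>neq_not_approx\<close>, and opposite signs,
      incompatible by \<open>approx_positive\<close>.\<close>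
    then have "(\<exists>a b. LF a \<phi> \<in> B \<and> LF b \<psi> \<in> B \<and> LNeq a b \<in> B) \<or>
        LF (LPos v) \<phi> \<in> B \<and> LF (LNeg u') \<psi> \<in> B \<or> LF (LNeg v') \<phi> \<in> B \<and> LF (LPos u) \<psi> \<in> B"
      using C(3,4) by auto
    then have "\<not> approx B \<phi> \<psi>"
      using neq_not_approx approx_positive negative positiveI by blast
    then show ?thesis
      using C(1) iden_neg negative by blast
  qed
qed

section \<open>Universe and operations of the countermodel\<close>

definition cls :: "fm \<Rightarrow> fm set + bool" where
  "cls \<phi> = Inl (Collect (approx B \<phi>))"

text \<open>An occurring \<open>\<phi>\<close> lies in its own class, so equal classes give
  equivalence. Two formulas off the branch share the empty class without being equivalent.\<close>

lemma cls_eq: "occurs \<phi> \<Longrightarrow> cls \<phi> = cls \<psi> \<longleftrightarrow> approx B \<phi> \<psi>"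
  using approx_refl approx_sym approx_trans unfolding cls_def
  by (metis (no_types, lifting) Collect_cong Inl_inject mem_Collect_eq)

definition designated :: "(fm set + bool) set" where
  "designated = insert (Inr True) (cls ` Collect positive)"

lemma Inr_designated [simp]: "Inr b \<in> designated \<longleftrightarrow> b"
  by (auto simp: designated_def cls_def)

lemma cls_designated:
  assumes "occurs \<phi>"
  shows "cls \<phi> \<in> designated \<longleftrightarrow> positive \<phi>"
proof -
  have "cls \<phi> \<noteq> Inr True"
    by (simp add: cls_def)
  then show ?thesis
    using cls_eq[OF assms] approx_positive by (auto simp: designated_def)
qed

text \<open>\<open>P\<close> describes the formulas on the branch that dictate the result of an
  operation, and \<open>d\<close> is the truth value that the result must have.\<close>

definition cls_or :: "(fm \<Rightarrow> bool) \<Rightarrow> bool \<Rightarrow> fm set + bool" where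
  "cls_or P d = (if Ex P then cls (SOME \<chi>. P \<chi>) else Inr d)"

lemma cls_or_eq:
  assumes "P \<chi>" "occurs \<chi>" "\<And>\<theta>. P \<theta> \<Longrightarrow> approx B \<chi> \<theta>"
  shows "cls_or P d = cls \<chi>"
proof -
  have "cls_or P d = cls (SOME \<theta>. P \<theta>)"
    unfolding cls_or_def using assms(1) by (subst if_P) blast+
  moreover have "P (SOME \<theta>. P \<theta>)"
    using assms(1) by (rule someI)
  ultimately show ?thesis
    using assms(3) cls_eq[OF assms(2)] by metis
qed

text \<open>A chosen formula has the right truth value by its sign, the spare element by its index.
  This gives the model conditions at all arguments, including those that are not classes of
  occurring formulas.\<close>

lemma cls_or_designated:
  assumes "\<And>\<chi>. P \<chi> \<Longrightarrow> occurs \<chi> \<and> (positive \<chi> \<longleftrightarrow> d)"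
  shows "cls_or P d \<in> designated \<longleftrightarrow> d"
proof (cases "Ex P")
  case True
  then have "P (SOME \<theta>. P \<theta>)"
    by (rule someI_ex)
  with True show ?thesis
    using assms cls_designated unfolding cls_or_def by (simp only: if_True)
next
  case False
  then show ?thesis
    unfolding cls_or_def by (simp only: if_False Inr_designated)
qed

definition binary ::
  "(fm \<Rightarrow> fm \<Rightarrow> fm) \<Rightarrow> fm set + bool \<Rightarrow> fm set + bool \<Rightarrow> bool \<Rightarrow> fm set + bool" where
  "binary c a b =
    cls_or (\<lambda>\<chi>. \<exists>\<phi> \<psi>. \<chi> = c \<phi> \<psi> \<and> occurs \<chi> \<and> a = cls \<phi> \<and> b = cls \<psi>)"

definition countermodel :: "(fm set + bool) sci_struct" where
  "countermodel = \<lparr>univ = UNIV, desig = designated,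
    negS = (\<lambda>a. cls_or (\<lambda>\<chi>. \<exists>\<phi>. \<chi> = Neg \<phi> \<and> occurs \<chi> \<and> a = cls \<phi>) (a \<notin> designated)),
    impS = (\<lambda>a b. binary Imp a b (a \<notin> designated \<or> b \<in> designated)),
    idenS = (\<lambda>a b. binary Iden a b (a = b))\<rparr>"

text \<open>Other representatives of the argument have equivalent negations by
  \<open>approx_Neg\<close>, so the choice made in \<open>cls_or\<close> does not affect the
  result.\<close>

lemma countermodel_Neg:
  assumes "occurs (Neg \<phi>)"
  shows "negS countermodel (cls \<phi>) = cls (Neg \<phi>)"
  unfolding countermodel_def sci_struct.simps
  by (rule cls_or_eq)
    (use assms occurs_Neg(1)[OF assms] in \<open>auto simp: cls_eq approx_refl intro: approx_Neg\<close>)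

lemma binary_cls:
  assumes "occurs (c \<phi> \<chi>)" "occurs \<phi>" "occurs \<chi>"
    and "\<And>\<psi> \<theta>. approx B \<phi> \<psi> \<Longrightarrow> approx B \<chi> \<theta> \<Longrightarrow> occurs (c \<psi> \<theta>) \<Longrightarrow> approx B (c \<phi> \<chi>) (c \<psi> \<theta>)"
  shows "binary c (cls \<phi>) (cls \<chi>) d = cls (c \<phi> \<chi>)"
  unfolding binary_def
proof (rule cls_or_eq)
  show "\<exists>\<psi> \<theta>. c \<phi> \<chi> = c \<psi> \<theta> \<and> occurs (c \<phi> \<chi>) \<and> cls \<phi> = cls \<psi> \<and> cls \<chi> = cls \<theta>"
    using assms(1) by blast
qed (use assms in \<open>auto simp: cls_eq\<close>)

lemma countermodel_Imp:
  "occurs (Imp \<phi> \<psi>) \<Longrightarrow> impS countermodel (cls \<phi>) (cls \<psi>) = cls (Imp \<phi> \<psi>)"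
  using occurs_Imp(1,2)[of \<phi> \<psi>] by (simp add: countermodel_def binary_cls approx_Imp)

lemma countermodel_Iden:
  "occurs (Iden \<phi> \<psi>) \<Longrightarrow> idenS countermodel (cls \<phi>) (cls \<psi>) = cls (Iden \<phi> \<psi>)"
  using occurs_Iden(1,2)[of \<phi> \<psi>] by (simp add: countermodel_def binary_cls approx_Iden)

lemma sci_model_countermodel: "sci_model countermodel"
proof -
  have "negS countermodel a \<in> designated \<longleftrightarrow> a \<notin> designated" for a
    unfolding countermodel_def sci_struct.simps
    by (rule cls_or_designated) (metis occurs_Neg cls_designated)
  moreover have "impS countermodel a b \<in> designated \<longleftrightarrow> a \<notin> designated \<or> b \<in> designated" for a b
    unfolding countermodel_def sci_struct.simps binary_def
    by (rule cls_or_designated) (metis occurs_Imp cls_designated)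
  \<comment> \<open>An occurring identity is positive exactly when its sides are equivalent, that
    is, when their classes coincide.\<close>
  moreover have "idenS countermodel a b \<in> designated \<longleftrightarrow> a = b" for a b
    unfolding countermodel_def sci_struct.simps binary_def
    by (rule cls_or_designated) (metis occurs_Iden cls_eq)
  moreover have "univ countermodel = UNIV" "desig countermodel = designated"
    by (simp_all add: countermodel_def)
  ultimately show ?thesis
    unfolding sci_model_def by simp
qed

section \<open>The canonical valuation\<close>

primrec canonical :: "fm \<Rightarrow> fm set + bool" where
  "canonical (Atom n) = cls (Atom n)"
| "canonical (Neg \<phi>) = negS countermodel (canonical \<phi>)"
| "canonical (Imp \<phi> \<psi>) = impS countermodel (canonical \<phi>) (canonical \<psi>)"
| "canonical (Iden \<phi> \<psi>) = idenS countermodel (canonical \<phi>) (canonical \<psi>)"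

lemma valuation_canonical: "valuation countermodel canonical"
  by (simp add: valuation_def) (simp add: countermodel_def)

text \<open>Subformulas of an occurring formula occur, and on their classes the operations return
  classes. Elsewhere \<open>cls\<close> need not commute with the operations, which is why
  \<open>canonical\<close> is defined by recursion.\<close>

lemma canonical_cls: "occurs \<phi> \<Longrightarrow> canonical \<phi> = cls \<phi>"
proof (induction \<phi>)
  case (Neg \<phi>)
  then show ?case
    using occurs_Neg(1)[of \<phi>] by (simp add: countermodel_Neg)
next
  case (Imp \<phi> \<psi>)
  then show ?case
    using occurs_Imp(1,2)[of \<phi> \<psi>] by (simp add: countermodel_Imp)
next
  case (Iden \<phi> \<psi>)
  then show ?case
    using occurs_Iden(1,2)[of \<phi> \<psi>] by (simp add: countermodel_Iden)
qed simp

lemma not_valid: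
  assumes "LF (LNeg n) \<phi> \<in> B"
  shows "\<not> valid \<phi>"
proof
  assume "valid \<phi>"
  \<comment> \<open>\<open>valid\<close> speaks of universes of natural numbers;
    \<open>valid_all_universes\<close> carries it over to the universe of classes.\<close>
  then have "canonical \<phi> \<in> designated"
    using valid_all_universes[OF _ sci_model_countermodel valuation_canonical]
    by (simp add: satisfied_def countermodel_def)
  moreover have "occurs \<phi>"
    using assms by (auto simp: occurs_def)
  ultimately show False
    using negative[OF assms] by (simp add: canonical_cls cls_designated)
qed

end

theorem theorem2:
  fixes \<phi> :: fm
  assumes "valid \<phi>"
  shows "\<exists>t. tableau_proof t \<phi>"
proof -
  let ?B = "{LF (LNeg 0) \<phi>}"
  have "closable ?B {}"
  proof (rule ccontr)
    assume "\<not> closable ?B {}"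
    then obtain B' where "?B \<subseteq> B'" "open_branch B'"
      using open_branch_extension[of ?B "{}"] by auto
    then show False
      using open_branch.not_valid assms by blast
  qed
  \<comment> \<open>Nonemptiness of \<open>ts\<close> matters: a root without children would be an
    open branch.\<close>
  then obtain ts where "expansion ?B {} ts" "ts \<noteq> []" "\<forall>t\<in>set ts. closed t"
    by (auto simp: closable_def)
  then have "tableau_proof (Node ?B ts) \<phi>"
    by (simp add: tableau_proof_def tableau_def closed_Node)
  then show ?thesis
    by blast
qed

end
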